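(* Let $c_n=\frac{(2n)!}{n!\,(n+1)!}$ be the Catalan numbers. The formal power series $h(t)=\sum_{n\ge0}(-1)^{n+1}c_n t^{3n+1}$ is its own inverse for composition: $h(h(t))=t$. *)

theory Defs
  imports "HOL-Computational_Algebra.Formal_Power_Series"
begin

definition catalan :: "nat \<Rightarrow> 'a::field_char_0" where
  "catalan n = fact (2 * n) / (fact n * fact (n + 1))"

(* The coefficients of the sum over n of (-1)^(n+1) * c_n * t^(3n+1): an index k of the
   form 3n+1 has n = k div 3, and all other coefficients vanish. *)
definition h_series :: "'a::field_char_0 fps" where
  "h_series = Abs_fps (\<lambda>k. if k mod 3 = 1 then (-1) ^ (k div 3 + 1) * catalan (k div 3) else 0)"

lemma h_series_nth: "fps_nth h_series (3 * n + 1) = (-1) ^ (n + 1) * catalan n"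
proof -
  have "(3 * n + 1) mod 3 = 1" "(3 * n + 1) div 3 = n"
    by presburger+
  then show ?thesis
    by (simp only: h_series_def fps_nth_Abs_fps if_True simp_thms)
qed

lemma h_series_nth_eq_0: "k mod 3 \<noteq> 1 \<Longrightarrow> fps_nth h_series k = 0"
  by (simp add: h_series_def)

(* fps_compose agrees with substitution only if the inner series has no constant term. *)
lemma h_series_nth_0: "fps_nth h_series 0 = 0"
  by (simp add: h_series_def)

end

theory Submission imports Defs begin

text \<open>
  The Catalan generating function \<open>C\<close> satisfies \<open>C = 1 + X C\<^sup>2\<close>. Since
  \<open>h(t) = - t C(-t\<^sup>3)\<close>, this turns into \<open>h + t = t\<^sup>2 h\<^sup>2\<close>, which is symmetric in
  \<open>t\<close> and \<open>h\<close>. Substituting \<open>h\<close> for \<open>t\<close> shows that \<open>k = h(h(t))\<close> satisfies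
  \<open>k + h = h\<^sup>2 k\<^sup>2\<close>, so \<open>k\<close> and \<open>t\<close> both solve the equation
  \<open>y + h = h\<^sup>2 y\<^sup>2\<close> in \<open>y\<close>. It has only one solution with zero constant term: the
  difference of two such solutions is annihilated by a series with constant term 1.

  The quadratic equation for \<open>C\<close> comes from the two-term recurrence of the Catalan
  numbers: it says that \<open>S = 1 - 2 X C\<close> solves \<open>(1 - 4 X) S' = - 2 S\<close>, so that
  \<open>S\<^sup>2\<close> and \<open>1 - 4 X\<close> solve the same first-order linear equation and agree at 0.
\<close>

lemma catalan_0: "catalan 0 = (1 :: 'a::field_char_0)"
  by (simp add: catalan_def)

lemma catalan_Suc:
  "of_nat (n + 2) * catalan (Suc n) = (2 * of_nat (2 * n + 1) * catalan n :: 'a::field_char_0)"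
proof -
  have nz: "of_nat (n + 2) \<noteq> (0::'a)" "of_nat (n + 1) \<noteq> (0::'a)"
    by (simp_all only: of_nat_eq_0_iff)
  have num: "fact (2 * Suc n) =
      2 * of_nat (n + 1) * of_nat (2 * n + 1) * (fact (2 * n) :: 'a)"
  proof -
    have "2 * Suc n = Suc (Suc (2 * n))"
      by simp
    then show ?thesis
      by (simp only: fact_Suc) (simp add: algebra_simps)
  qed
  have den: "fact (Suc n) = of_nat (n + 1) * (fact n :: 'a)"
    "fact (Suc n + 1) = of_nat (n + 2) * (fact (n + 1) :: 'a)"
    by simp_all
  show ?thesis
    unfolding catalan_def num den using nz
    by (simp del: of_nat_add of_nat_mult of_nat_Suc fact_Suc add: divide_simps)
qed

text \<open>The ordinary generating function of the Catalan numbers.\<close>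

definition catalan_fps :: "'a::field_char_0 fps" where
  "catalan_fps = Abs_fps catalan"

lemma fps_linear_ode_eq_0:
  fixes G :: "'a::field_char_0 fps"
  assumes ode: "(1 - fps_const c * fps_X) * fps_deriv G = fps_const d * G"
    and zero: "fps_nth G 0 = 0"
  shows "G = 0"
proof (rule fps_ext)
  fix n
  show "fps_nth G n = fps_nth 0 n"
  proof (induction n)
    case 0
    then show ?case using zero by simp
  next
    case (Suc n)
    have "fps_nth ((1 - fps_const c * fps_X) * fps_deriv G) n = fps_nth (fps_const d * G) n"
      using ode by simp
    then have "of_nat (Suc n) * fps_nth G (Suc n) = 0"
      using Suc by (cases n) (simp_all add: algebra_simps del: of_nat_Suc)
    then show ?case
      by (simp del: of_nat_Suc)
  qed
qed

lemma catalan_fps_ode: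
  fixes S :: "'a::field_char_0 fps"
  defines "S \<equiv> 1 - fps_const 2 * (fps_X * catalan_fps)"
  shows "(1 - fps_const 4 * fps_X) * fps_deriv S = fps_const (- 2) * S"
proof (rule fps_ext)
  have S0: "fps_nth S 0 = 1"
    by (simp add: S_def)
  have S_Suc: "fps_nth S (Suc n) = - 2 * catalan n" for n
    by (simp add: S_def catalan_fps_def)
  fix n
  have mult_nth: "fps_nth ((1 - fps_const 4 * fps_X) * F) n =
      fps_nth F n - 4 * (if n = 0 then 0 else fps_nth F (n - 1))" for F :: "'a fps"
    by (simp add: left_diff_distrib mult.assoc)
  show "fps_nth ((1 - fps_const 4 * fps_X) * fps_deriv S) n = fps_nth (fps_const (- 2) * S) n"
  proof (cases n)
    case 0
    then show ?thesis
      by (simp add: mult_nth S0 S_Suc catalan_0)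
  next
    case (Suc m)
    then show ?thesis
      using arg_cong[OF catalan_Suc[of m, where 'a = 'a], of "\<lambda>x. 2 * x"]
      by (simp add: mult_nth S_Suc algebra_simps)
  qed
qed

lemma catalan_fps_eq:
  "catalan_fps = 1 + fps_X * (catalan_fps :: 'a::field_char_0 fps)\<^sup>2"
proof -
  let ?C = "catalan_fps :: 'a fps"
  define S where "S = 1 - fps_const 2 * (fps_X * ?C)"
  have ode: "(1 - fps_const 4 * fps_X) * fps_deriv S = fps_const (- 2) * S"
    using catalan_fps_ode[where 'a = 'a] by (simp only: S_def)
  have "(1 - fps_const 4 * fps_X) * fps_deriv (S * S) =
      2 * S * ((1 - fps_const 4 * fps_X) * fps_deriv S)"
    by (simp add: algebra_simps)
  also have "\<dots> = fps_const (- 4) * (S * S)"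
    unfolding ode by (simp add: numeral_fps_const flip: fps_const_neg)
  finally have "(1 - fps_const 4 * fps_X) * fps_deriv (S * S - (1 - fps_const 4 * fps_X)) =
      fps_const (- 4) * (S * S - (1 - fps_const 4 * fps_X))"
    by (simp add: algebra_simps flip: fps_const_neg)
  moreover have "fps_nth (S * S - (1 - fps_const 4 * fps_X)) 0 = 0"
    by (simp add: S_def)
  ultimately have "S * S - (1 - fps_const 4 * fps_X) = 0"
    by (rule fps_linear_ode_eq_0)
  then have "4 * fps_X * (1 + fps_X * ?C\<^sup>2 - ?C) = 0"
    by (simp add: S_def algebra_simps power2_eq_square flip: numeral_fps_const)
  then show ?thesis
    by simp
qed

lemma fps_nth_compose_neg_fps_X_power:
  fixes f :: "'a::comm_ring_1 fps"
  assumes "d > 0"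
  shows "fps_nth (f oo - (fps_X ^ d)) n =
    (if d dvd n then (-1) ^ (n div d) * fps_nth f (n div d) else 0)"
proof -
  have pow: "fps_nth ((- (fps_X ^ d)) ^ i) n = (if n = d * i then (-1) ^ i else 0 :: 'a)" for i
    by (subst power_minus) (cases "even i"; simp add: fps_X_power_nth flip: power_mult)
  have "fps_nth (f oo - (fps_X ^ d)) n =
      (\<Sum>i = 0..n. fps_nth f i * (if n = d * i then (-1) ^ i else 0))"
    by (simp add: fps_compose_nth pow)
  also have "\<dots> = (\<Sum>i \<in> (if d dvd n then {n div d} else {}).
      fps_nth f i * (if n = d * i then (-1) ^ i else 0))"
    using assms by (intro sum.mono_neutral_right) auto
  finally show ?thesis
    by (simp add: mult.commute)
qed

lemma h_series_eq_catalan_fps: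
  "h_series = - fps_X * (catalan_fps oo - (fps_X ^ 3) :: 'a::field_char_0 fps)"
proof (rule fps_ext)
  fix k
  show "fps_nth h_series k = fps_nth (- fps_X * (catalan_fps oo - (fps_X ^ 3)) :: 'a fps) k"
  proof (cases k)
    case 0
    then show ?thesis
      by (simp add: h_series_nth_0)
  next
    case (Suc m)
    have "Suc m mod 3 = 1 \<longleftrightarrow> 3 dvd m" "3 dvd m \<Longrightarrow> Suc m div 3 = m div 3"
      by presburger+
    then show ?thesis
      by (auto simp add: Suc h_series_def catalan_fps_def fps_nth_compose_neg_fps_X_power)
  qed
qed

text \<open>The symmetric relation between \<open>t\<close> and \<open>h(t)\<close>.\<close>

lemma h_series_eq:
  "h_series + fps_X = fps_X\<^sup>2 * (h_series :: 'a::field_char_0 fps)\<^sup>2"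
proof -
  define D :: "'a fps" where "D = catalan_fps oo (- (fps_X ^ 3))"
  have "D = (1 + fps_X * catalan_fps\<^sup>2) oo (- (fps_X ^ 3))"
    unfolding D_def by (subst catalan_fps_eq) (rule refl)
  also have "\<dots> = 1 - fps_X ^ 3 * D\<^sup>2"
    by (simp add: D_def fps_compose_add_distrib fps_compose_mult_distrib fps_compose_power)
  finally have D: "D = 1 - fps_X ^ 3 * D\<^sup>2" .
  have h: "h_series = - fps_X * D"
    by (simp add: D_def h_series_eq_catalan_fps)
  have "h_series + fps_X = fps_X * (1 - D)"
    by (simp add: h algebra_simps)
  also have "1 - D = fps_X ^ 3 * D\<^sup>2"
    by (subst D) simp
  finally show ?thesis
    by (simp add: h power2_eq_square power3_eq_cube algebra_simps)
qed

theorem mainTheorem3: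
  shows "fps_compose h_series h_series = (fps_X :: 'a::field_char_0 fps)"
proof -
  let ?h = "h_series :: 'a fps"
  define k where "k = ?h oo ?h"
  have "(?h + fps_X) oo ?h = (fps_X\<^sup>2 * ?h\<^sup>2) oo ?h"
    by (simp only: h_series_eq)
  then have k: "k + ?h = ?h\<^sup>2 * k\<^sup>2"
    by (simp add: k_def h_series_nth_0 fps_compose_add_distrib fps_compose_mult_distrib
        power2_eq_square)
  have "(k - fps_X) * (1 - ?h\<^sup>2 * (k + fps_X)) =
      (k + ?h - ?h\<^sup>2 * k\<^sup>2) - (?h + fps_X - fps_X\<^sup>2 * ?h\<^sup>2)"
    by (simp add: algebra_simps power2_eq_square)
  also have "\<dots> = 0"
    by (simp only: k h_series_eq) simp
  finally have "(k - fps_X) * (1 - ?h\<^sup>2 * (k + fps_X)) = 0" .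
  moreover have "fps_nth (1 - ?h\<^sup>2 * (k + fps_X)) 0 = 1"
    by (simp add: h_series_nth_0 power2_eq_square)
  then have "1 - ?h\<^sup>2 * (k + fps_X) \<noteq> 0"
    by (metis fps_zero_nth zero_neq_one)
  ultimately show ?thesis
    by (simp add: k_def)
qed

end
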